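(* Let $\mathcal{M}$ be a smooth manifold and let $\big(g_k\colon\mathcal{M}\to\mathcal{M}\big)_{k\ge0}$ be a non-autonomous dynamical system such that each map $g_k$ has the Luzin $N^{-1}$ property. Then the system avoids its set of NPH (non-uniformly pseudo-hyperbolic) unstable fixed points.
   Context: Measure zero on manifolds: a set $A\subset\mathcal{M}$ has measure zero if for every smooth chart $(U,\varphi)$ of $\mathcal{M}$, $\varphi(A\cap U)\subset\mathbb{R}^d$ (with $d=\dim\mathcal{M}$) has Lebesgue measure zero. A map $g\colon\mathcal{M}\to\mathcal{M}$ has the Luzin $N^{-1}$ property if $g^{-1}(E)$ has measure zero for every $E\subseteq\mathcal{M}$ of measure zero. The system avoids a set $S\subseteq\mathcal{M}$ of fixed points if the set of $x_0\in\mathcal{M}$ for which the trajectory $x_{k+1}=g_k(x_k)$, $k\ge0$, converges to some point of $S$ has measure zero. NPH unstable fixed point on a manifold. Let $x^\ast\in\mathcal{M}$ satisfy $g_k(x^\ast)=x^\ast$ for all $k\ge0$. It is an NPH unstable fixed point of $(g_k)_{k\ge0}$ if there exist smooth maps $\psi\colon\mathrm{T}_{x^\ast}\mathcal{M}\to\mathcal{M}$ and $\hat\psi\colon\mathcal{M}\to\mathrm{T}_{x^\ast}\mathcal{M}$, a neighborhood $U$ of $x^\ast$ in $\mathcal{M}$ and a neighborhood $V$ of $0$ in $\mathrm{T}_{x^\ast}\mathcal{M}$ such that $\psi(0)=x^\ast$, the restrictions $\psi|_V\colon V\to U$ and $\hat\psi|_U\colon U\to V$ are each other's inverse, and $0\in\mathrm{T}_{x^\ast}\mathcal{M}$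 is an NPH unstable fixed point (in the vector space sense below) of the lifted system $(\tilde g_k:=\hat\psi\circ g_k\circ\psi\colon\mathrm{T}_{x^\ast}\mathcal{M}\to\mathrm{T}_{x^\ast}\mathcal{M})_{k\ge0}$. NPH unstable fixed point at the origin of a finite-dimensional real vector space $X$ (i.e. $X\cong\mathbb{R}^d$). Given a splitting $X=E_{\mathrm{cs}}\oplus E_{\mathrm{u}}$ into complementary linear subspaces and norms on $E_{\mathrm{cs}},E_{\mathrm{u}}$, equip $X$ with the max-norm $\|y+z\|=\max(\|y\|_{E_{\mathrm{cs}}},\|z\|_{E_{\mathrm{u}}})$ for $y\in E_{\mathrm{cs}},z\in E_{\mathrm{u}}$; $B_r(0)$ is the open ball, and $\mathrm{Lip}(h|_U)\in[0,\infty]$ is the Lipschitz constant of $h$ on $U$. For a map $g\colon X\to X$, a linear map $T\colon X\to X$, reals $1\le\lambda<\mu$ and $\varepsilon>0$, and an open neighborhood $U$ of $0$, write $(g,T)\in\mathrm{PH}(\mu,\lambda,\varepsilon;U,E_{\mathrm{cs}}\oplus E_{\mathrm{u}})$ if: (1) $g(0)=0$; (2) $T(E_{\mathrm{cs}})\subseteq E_{\mathrm{cs}}$, $T(E_{\mathrm{u}})\subseteq E_{\mathrm{u}}$; (3) $\|Ty\|\le\lambda\|y\|$ for $y\in E_{\mathrm{cs}}$ and $\|Tz\|\ge\mu\|z\|$ for $z\in E_{\mathrm{u}}$; (4) $\mathrm{Lip}((g-T)|_U)\le\varepsilon<(\mu-\lambda)/4$. The origin is an NPH unstable fixed point of $(\tilde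 g_k\colon X\to X)_{k\ge0}$ if $\tilde g_k(0)=0$ for all $k\ge0$ and there exist a splitting $X=E_{\mathrm{cs}}\oplus E_{\mathrm{u}}$ with $\dim E_{\mathrm{u}}\ge1$, norms on $E_{\mathrm{cs}},E_{\mathrm{u}}$, linear maps $(T_k\colon X\to X)_{k\ge0}$, $r>0$, $K\ge0$ and positive constants $(\mu_k,\lambda_k,\varepsilon_k)_{k\ge K}$ such that: (a) $(\tilde g_k,T_k)\in\mathrm{PH}(\mu_k,\lambda_k,\varepsilon_k/4;B_r(0),E_{\mathrm{cs}}\oplus E_{\mathrm{u}})$ (with respect to these same norms) for all $k\ge K$; (b) $\varepsilon_k<(\mu_k-\lambda_k)/4$ for all $k\ge K$; (c) $\sum_{k=K}^\infty\varepsilon_k/(\mu_k-2\varepsilon_k)=+\infty$. *)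

theory Defs
  imports "HOL-Analysis.Analysis" "HOL-Library.Function_Algebras"
begin

section \<open>Smooth maps between open subsets of Euclidean spaces\<close>

text \<open>Only meant for open \<open>S\<close>: derivatives are taken in the ambient space.\<close>

primrec Ck_on :: "nat \<Rightarrow> 'b::euclidean_space set \<Rightarrow> ('b \<Rightarrow> 'c::euclidean_space) \<Rightarrow> bool" where
  "Ck_on 0 S f \<longleftrightarrow> continuous_on S f"
| "Ck_on (Suc k) S f \<longleftrightarrow> (\<forall>x\<in>S. f differentiable (at x)) \<and>
     (\<forall>v. Ck_on k S (\<lambda>x. frechet_derivative f (at x) v))"

definition smooth_on :: "'b::euclidean_space set \<Rightarrow> ('b \<Rightarrow> 'c::euclidean_space) \<Rightarrow> bool" where
  "smooth_on S f \<longleftrightarrow> (\<forall>k. Ck_on k S f)"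


section \<open>Smooth manifolds\<close>

text \<open>A chart is a pair \<open>(U, \<phi>)\<close>; the values of \<open>\<phi>\<close> outside \<open>U\<close> are irrelevant.
  The manifold is the whole type \<open>'a\<close>, its dimension is \<open>DIM('b)\<close>.\<close>

type_synonym ('a, 'b) chart = "'a set \<times> ('a \<Rightarrow> 'b)"

definition is_chart :: "('a::topological_space, 'b::euclidean_space) chart \<Rightarrow> bool" where
  "is_chart = (\<lambda>(U, \<phi>). open U \<and> open (\<phi> ` U) \<and> homeomorphism U (\<phi> ` U) \<phi> (inv_into U \<phi>))"

definition smoothly_compatible ::
  "('a, 'b::euclidean_space) chart \<Rightarrow> ('a, 'b) chart \<Rightarrow> bool" where
  "smoothly_compatible = (\<lambda>(U, \<phi>) (V, \<kappa>).
     smooth_on (\<phi> ` (U \<inter> V)) (\<kappa> \<circ> inv_into U \<phi>) \<and>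
     smooth_on (\<kappa> ` (U \<inter> V)) (\<phi> \<circ> inv_into V \<kappa>))"

definition smooth_atlas :: "('a::topological_space, 'b::euclidean_space) chart set \<Rightarrow> bool" where
  "smooth_atlas \<A> \<longleftrightarrow> (\<forall>c\<in>\<A>. is_chart c) \<and> (\<Union>(fst ` \<A>)) = UNIV \<and>
     (\<forall>c\<in>\<A>. \<forall>c'\<in>\<A>. smoothly_compatible c c')"

text \<open>A smooth structure is a maximal smooth atlas; its members are the smooth charts. The
  sort constraint records that manifolds are Hausdorff and second countable.\<close>

definition smooth_structure ::
  "('a::{t2_space, second_countable_topology}, 'b::euclidean_space) chart set \<Rightarrow> bool" where
  "smooth_structure \<A> \<longleftrightarrow> smooth_atlas \<A> \<and>
     (\<forall>c. is_chart c \<and> (\<forall>c'\<in>\<A>. smoothly_compatible c c') \<longrightarrow> c \<in> \<A>)"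

text \<open>The atlases need not cover the whole types \<open>'a\<close>, \<open>'c\<close>: this is applied to maps
  into and out of a tangent space, which is a set.\<close>

definition smooth_map ::
  "('a, 'b::euclidean_space) chart set \<Rightarrow> ('c, 'd::euclidean_space) chart set \<Rightarrow> ('a \<Rightarrow> 'c) \<Rightarrow> bool"
  where
  "smooth_map \<A> \<B> f \<longleftrightarrow>
     (\<forall>p\<in>\<Union>(fst ` \<A>). \<exists>(U, \<phi>)\<in>\<A>. \<exists>(V, \<kappa>)\<in>\<B>.
        p \<in> U \<and> f ` U \<subseteq> V \<and> smooth_on (\<phi> ` U) (\<kappa> \<circ> f \<circ> inv_into U \<phi>))"

definition measure_zero :: "('a, 'b::euclidean_space) chart set \<Rightarrow> 'a set \<Rightarrow> bool" where
  "measure_zero \<A> S \<longleftrightarrow> (\<forall>(U, \<phi>)\<in>\<A>. \<phi> ` (S \<inter> U) \<in> null_sets lebesgue)"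

definition luzin_N_inverse :: "('a, 'b::euclidean_space) chart set \<Rightarrow> ('a \<Rightarrow> 'a) \<Rightarrow> bool" where
  "luzin_N_inverse \<A> g \<longleftrightarrow> (\<forall>E. measure_zero \<A> E \<longrightarrow> measure_zero \<A> (g -` E))"


section \<open>Tangent spaces\<close>

text \<open>Pointwise real vector space structure on functions; zero, addition and subtraction are those
  of \<^theory>\<open>HOL-Library.Function_Algebras\<close>.\<close>

instantiation "fun" :: (type, real_vector) real_vector
begin

definition scaleR_fun :: "real \<Rightarrow> ('a \<Rightarrow> 'b) \<Rightarrow> 'a \<Rightarrow> 'b" where
  "scaleR_fun c f = (\<lambda>x. c *\<^sub>R f x)"

instance
  by standard (auto simp: scaleR_fun_def fun_eq_iff algebra_simps)

end

text \<open>A tangent vector at \<open>p\<close> is given by its coordinate vectors in all smooth charts around \<open>p\<close>,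
  related by the derivatives of the transition maps. The second condition only fixes a dummy value
  for pairs that are not smooth charts around \<open>p\<close>.\<close>

definition tangent_space ::
  "('a, 'b::euclidean_space) chart set \<Rightarrow> 'a \<Rightarrow> (('a, 'b) chart \<Rightarrow> 'b) set" where
  "tangent_space \<A> p = {v.
     (\<forall>(U, \<phi>)\<in>\<A>. \<forall>(V, \<kappa>)\<in>\<A>. p \<in> U \<and> p \<in> V \<longrightarrow>
        v (V, \<kappa>) = frechet_derivative (\<kappa> \<circ> inv_into U \<phi>) (at (\<phi> p)) (v (U, \<phi>))) \<and>
     (\<forall>c. \<not> (c \<in> \<A> \<and> p \<in> fst c) \<longrightarrow> v c = 0)}"

text \<open>An atlas for the standard smooth structure (and topology) of a real vector space \<open>X\<close> of
  dimension \<open>DIM('b)\<close>: the inverses of the linear isomorphisms from \<open>'b\<close> onto \<open>X\<close>, restricted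
  to open sets. In particular the open sets of \<open>X\<close> are exactly the domains of these charts.\<close>

definition linear_charts :: "'v::real_vector set \<Rightarrow> ('v, 'b::euclidean_space) chart set" where
  "linear_charts X = {(L ` W, inv L) | (L :: 'b \<Rightarrow> 'v) W.
     linear L \<and> bij_betw L UNIV X \<and> open W}"


section \<open>Non-uniform pseudo-hyperbolicity at the origin of a vector space\<close>

text \<open>A vector space is a subspace \<open>X\<close> of a type of class \<open>real_vector\<close>, and maps
  on \<open>X\<close> are functions on the type of which only the values on \<open>X\<close> matter.\<close>

definition is_norm_on :: "'v::real_vector set \<Rightarrow> ('v \<Rightarrow> real) \<Rightarrow> bool" where
  "is_norm_on E N \<longleftrightarrow> (\<forall>v\<in>E. 0 \<le> N v) \<and> (\<forall>v\<in>E. N v = 0 \<longleftrightarrow> v = 0) \<and>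
     (\<forall>v\<in>E. \<forall>c. N (c *\<^sub>R v) = \<bar>c\<bar> * N v) \<and> (\<forall>v\<in>E. \<forall>w\<in>E. N (v + w) \<le> N v + N w)"

definition linear_self_map :: "'v::real_vector set \<Rightarrow> ('v \<Rightarrow> 'v) \<Rightarrow> bool" where
  "linear_self_map X T \<longleftrightarrow> T \<in> X \<rightarrow> X \<and> (\<forall>v\<in>X. \<forall>w\<in>X. T (v + w) = T v + T w) \<and>
     (\<forall>c. \<forall>v\<in>X. T (c *\<^sub>R v) = c *\<^sub>R T v)"

definition splitting :: "'v::real_vector set \<Rightarrow> 'v set \<Rightarrow> 'v set \<Rightarrow> bool" where
  "splitting X Ecs Eu \<longleftrightarrow> subspace Ecs \<and> subspace Eu \<and>
     X = {y + z | y z. y \<in> Ecs \<and> z \<in> Eu} \<and> Ecs \<inter> Eu = {0}"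

definition max_norm ::
  "'v::real_vector set \<Rightarrow> ('v \<Rightarrow> real) \<Rightarrow> 'v set \<Rightarrow> ('v \<Rightarrow> real) \<Rightarrow> 'v \<Rightarrow> real" where
  "max_norm Ecs Ncs Eu Nu x =
     (THE m. \<exists>y\<in>Ecs. \<exists>z\<in>Eu. x = y + z \<and> m = max (Ncs y) (Nu z))"

definition norm_ball :: "'v::real_vector set \<Rightarrow> ('v \<Rightarrow> real) \<Rightarrow> real \<Rightarrow> 'v set" where
  "norm_ball X N r = {x \<in> X. N x < r}"

definition Lip :: "('v::real_vector \<Rightarrow> real) \<Rightarrow> ('v \<Rightarrow> 'v) \<Rightarrow> 'v set \<Rightarrow> ennreal" where
  "Lip N h U = (SUP (x, y)\<in>{(x, y). x \<in> U \<and> y \<in> U \<and> x \<noteq> y}. ennreal (N (h x - h y) / N (x - y)))"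

text \<open>\<open>\<nu>\<close> is the growth bound on \<open>Ecs\<close> (usually written lambda, which is reserved syntax
  here). Linearity of \<open>T\<close> is required in \<open>NPH_unstable_origin\<close>.\<close>

definition PH ::
  "('v::real_vector \<Rightarrow> 'v) \<Rightarrow> ('v \<Rightarrow> 'v) \<Rightarrow> real \<Rightarrow> real \<Rightarrow> real \<Rightarrow> 'v set \<Rightarrow>
   'v set \<Rightarrow> ('v \<Rightarrow> real) \<Rightarrow> 'v set \<Rightarrow> ('v \<Rightarrow> real) \<Rightarrow> bool" where
  "PH g T \<mu> \<nu> \<epsilon> U Ecs Ncs Eu Nu \<longleftrightarrow>
     (let N = max_norm Ecs Ncs Eu Nu in
       1 \<le> \<nu> \<and> \<nu> < \<mu> \<and> 0 < \<epsilon> \<and>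
       g 0 = 0 \<and>
       T ` Ecs \<subseteq> Ecs \<and> T ` Eu \<subseteq> Eu \<and>
       (\<forall>y\<in>Ecs. N (T y) \<le> \<nu> * N y) \<and> (\<forall>z\<in>Eu. N (T z) \<ge> \<mu> * N z) \<and>
       Lip N (\<lambda>x. g x - T x) U \<le> ennreal \<epsilon> \<and> \<epsilon> < (\<mu> - \<nu>) / 4)"

text \<open>The values of \<open>\<mu>\<close>, \<open>\<nu>\<close>, \<open>\<epsilon>\<close> below the index \<open>K\<close> are irrelevant.\<close>

definition NPH_unstable_origin ::
  "'v::real_vector set \<Rightarrow> (nat \<Rightarrow> 'v \<Rightarrow> 'v) \<Rightarrow> bool" where
  "NPH_unstable_origin X g \<longleftrightarrow> (\<forall>k. g k 0 = 0) \<and>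
     (\<exists>Ecs Eu Ncs Nu (T :: nat \<Rightarrow> 'v \<Rightarrow> 'v) (r :: real) (K :: nat)
        (\<mu> :: nat \<Rightarrow> real) (\<nu> :: nat \<Rightarrow> real) (\<epsilon> :: nat \<Rightarrow> real).
        splitting X Ecs Eu \<and> dim Eu \<ge> 1 \<and> is_norm_on Ecs Ncs \<and> is_norm_on Eu Nu \<and>
        (\<forall>k. linear_self_map X (T k)) \<and> r > 0 \<and>
        (\<forall>k\<ge>K. \<mu> k > 0 \<and> \<nu> k > 0 \<and> \<epsilon> k > 0) \<and>
        (\<forall>k\<ge>K. PH (g k) (T k) (\<mu> k) (\<nu> k) (\<epsilon> k / 4)
           (norm_ball X (max_norm Ecs Ncs Eu Nu) r) Ecs Ncs Eu Nu) \<and>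
        (\<forall>k\<ge>K. \<epsilon> k < (\<mu> k - \<nu> k) / 4) \<and>
        filterlim (\<lambda>n. \<Sum>k=K..<n. \<epsilon> k / (\<mu> k - 2 * \<epsilon> k)) at_top sequentially)"


section \<open>NPH unstable fixed points on a manifold\<close>

text \<open>\<open>U\<close> and \<open>V\<close> are neighborhoods that need not be open.\<close>

definition NPH_unstable_fixed_point ::
  "('a::{t2_space, second_countable_topology}, 'b::euclidean_space) chart set \<Rightarrow>
   (nat \<Rightarrow> 'a \<Rightarrow> 'a) \<Rightarrow> 'a \<Rightarrow> bool" where
  "NPH_unstable_fixed_point \<A> g x \<longleftrightarrow> (\<forall>k. g k x = x) \<and>
     (let X = tangent_space \<A> x; \<L> = (linear_charts X :: (_, 'b) chart set) in
       \<exists>\<psi> \<psi>' U V.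
         \<psi>' \<in> UNIV \<rightarrow> X \<and> smooth_map \<L> \<A> \<psi> \<and> smooth_map \<A> \<L> \<psi>' \<and>
         (\<exists>U\<^sub>0. open U\<^sub>0 \<and> x \<in> U\<^sub>0 \<and> U\<^sub>0 \<subseteq> U) \<and>
         V \<subseteq> X \<and> (\<exists>(V\<^sub>0, \<kappa>)\<in>\<L>. 0 \<in> V\<^sub>0 \<and> V\<^sub>0 \<subseteq> V) \<and>
         \<psi> 0 = x \<and>
         \<psi> ` V \<subseteq> U \<and> \<psi>' ` U \<subseteq> V \<and> (\<forall>v\<in>V. \<psi>' (\<psi> v) = v) \<and> (\<forall>u\<in>U. \<psi> (\<psi>' u) = u) \<and>
         NPH_unstable_origin X (\<lambda>k. \<psi>' \<circ> g k \<circ> \<psi>))"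

primrec trajectory :: "(nat \<Rightarrow> 'a \<Rightarrow> 'a) \<Rightarrow> 'a \<Rightarrow> nat \<Rightarrow> 'a" where
  "trajectory g x\<^sub>0 0 = x\<^sub>0"
| "trajectory g x\<^sub>0 (Suc k) = g k (trajectory g x\<^sub>0 k)"

definition avoids ::
  "('a::topological_space, 'b::euclidean_space) chart set \<Rightarrow> (nat \<Rightarrow> 'a \<Rightarrow> 'a) \<Rightarrow> 'a set \<Rightarrow> bool"
  where
  "avoids \<A> g S \<longleftrightarrow> measure_zero \<A> {x\<^sub>0. \<exists>s\<in>S. trajectory g x\<^sub>0 \<longlonglongrightarrow> s}"

end

theory Submission
  imports Defs
begin

text \<open>
  No centre-stable manifold has to be constructed; its Lipschitz estimate alone suffices. In
  coordinates around an NPH unstable fixed point, let \<open>P\<close> be the projection onto the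
  centre-stable space along the unstable space. If the difference \<open>w\<close> of two points lies in the
  unstable cone \<open>N (P w) \<le> N (w - P w)\<close>, then the pseudo-hyperbolic estimates keep it in this cone
  and multiply its norm by at least \<open>1 + \<epsilon> k\<close> in step \<open>k\<close> (\<open>unstable_cone_step\<close>). The divergence
  condition implies \<open>(\<Sum>k. \<epsilon> k) = \<infinity>\<close>, so these factors have an unbounded product, which two
  distinct orbits that remain in a ball cannot accommodate (\<open>NPH_trapped_orbits\<close>). Hence any two
  points with trapped orbits satisfy \<open>N (u - v) \<le> N (P (u - v))\<close>: the trapped points form a
  Lipschitz graph over a subset of a proper subspace, which is a null set
  (\<open>negligible_Lipschitz_graph\<close>).

  The smooth map \<open>\<psi>\<close> carries this null set to the manifold. So every NPH unstable fixed point has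
  an open neighbourhood \<open>Q\<close> such that, for all late starting times, the points whose orbits stay in
  \<open>Q\<close> forever have measure zero (\<open>NPH_neighbourhood\<close>). This concerns all orbits that stay in \<open>Q\<close>,
  whatever their limits, which is what makes an uncountable set of fixed points harmless: by
  second countability, countably many such neighbourhoods cover all of them. A trajectory that
  converges to one of the fixed points is from some time on trapped in one of the countably many
  neighbourhoods, and the Luzin property pulls the null sets back along the first iterations.
\<close>

section \<open>Norms on subspaces\<close>

lemma norm_on_properties:
  assumes N: "is_norm_on X N" and X: "subspace X"
  shows "N 0 = 0"
    and "v \<in> X \<Longrightarrow> N (- v) = N v"
    and "u \<in> X \<Longrightarrow> v \<in> X \<Longrightarrow> N (u - v) \<le> N u + N v"
    and "u \<in> X \<Longrightarrow> v \<in> X \<Longrightarrow> N u - N v \<le> N (u + v)"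
proof -
  show "N 0 = 0"
    using N subspace_0[OF X] by (auto simp: is_norm_on_def)
  have minus: "N (- v) = N v" if "v \<in> X" for v
  proof -
    have "N ((-1) *\<^sub>R v) = \<bar>-1\<bar> * N v"
      using N that unfolding is_norm_on_def by blast
    then show ?thesis by simp
  qed
  then show "v \<in> X \<Longrightarrow> N (- v) = N v" .
  have tri: "N (u + v) \<le> N u + N v" if "u \<in> X" "v \<in> X" for u v
    using N that by (auto simp: is_norm_on_def)
  show diff: "N (u - v) \<le> N u + N v" if "u \<in> X" "v \<in> X" for u v
    using tri[of u "- v"] minus[of v] that subspace_neg[OF X] by simp
  show "N u - N v \<le> N (u + v)" if "u \<in> X" "v \<in> X"
    using diff[of "u + v" v] that subspace_add[OF X] by simp
qed

text \<open>The basis expansion bounds \<open>p\<close> above, hence \<open>p\<close> is continuous, and its minimum on the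
  compact unit sphere gives the reverse bound.\<close>

lemma norm_on_equivalent:
  fixes p :: "'b::euclidean_space \<Rightarrow> real"
  assumes p: "is_norm_on UNIV p"
  obtains c C where "c > 0" "\<And>v. p v \<le> c * norm v" "C > 0" "\<And>v. norm v \<le> C * p v"
proof -
  note props = norm_on_properties[OF p subspace_UNIV, simplified]
  have nonneg: "0 \<le> p v" and zero: "p v = 0 \<longleftrightarrow> v = 0"
    and scale: "p (a *\<^sub>R v) = \<bar>a\<bar> * p v" and tri: "p (v + w) \<le> p v + p w" for a v w
    using p by (auto simp: is_norm_on_def)
  have sum_le: "p (sum f A) \<le> (\<Sum>i\<in>A. p (f i))" if "finite A" for f :: "'b \<Rightarrow> 'b" and A
    using that
  proof induction
    case empty
    then show ?case by (simp add: props(1))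
  next
    case (insert i A)
    then show ?case using tri[of "f i" "sum f A"] by simp
  qed
  define c where "c = (\<Sum>b\<in>Basis. p b) + 1"
  have c: "c > 0"
    unfolding c_def using sum_nonneg[of Basis p] nonneg by (simp add: add_nonneg_pos)
  have upper: "p v \<le> c * norm v" for v
  proof -
    have "p v = p (\<Sum>b\<in>Basis. (v \<bullet> b) *\<^sub>R b)"
      by (simp add: euclidean_representation)
    also have "\<dots> \<le> (\<Sum>b\<in>Basis. p ((v \<bullet> b) *\<^sub>R b))"
      by (rule sum_le) simp
    also have "\<dots> \<le> (\<Sum>b\<in>Basis. norm v * p b)"
      by (rule sum_mono) (simp add: scale mult_right_mono nonneg Basis_le_norm)
    also have "\<dots> \<le> c * norm v"
      by (simp add: c_def sum_distrib_left algebra_simps)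
    finally show ?thesis .
  qed
  have cont: "continuous_on UNIV p"
  proof (rule continuous_on_iff[THEN iffD2], intro ballI allI impI)
    fix v :: 'b and e :: real assume "e > 0"
    have "dist (p w) (p v) < e" if "dist w v < e / c" for w
    proof -
      have "\<bar>p w - p v\<bar> \<le> p (w - v)"
        using tri[of "w - v" v] tri[of "v - w" w] props(2)[of "v - w"] by simp
      also have "\<dots> \<le> c * norm (w - v)" by (rule upper)
      also have "\<dots> < e" using that c by (simp add: dist_norm field_simps)
      finally show ?thesis by (simp add: dist_real_def)
    qed
    then show "\<exists>d>0. \<forall>w\<in>UNIV. dist w v < d \<longrightarrow> dist (p w) (p v) < e"
      using \<open>e > 0\<close> c by (intro exI[of _ "e / c"]) auto
  qed
  have "\<exists>C>0. \<forall>v. norm v \<le> C * p v"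
  proof -
    have "sphere (0::'b) 1 \<noteq> {}" by simp
    then obtain s where s: "s \<in> sphere 0 1" "\<And>v. v \<in> sphere 0 1 \<Longrightarrow> p s \<le> p v"
      using continuous_attains_inf[OF compact_sphere _ continuous_on_subset[OF cont subset_UNIV]]
      by blast
    have ps: "p s > 0"
      using s(1) zero[of s] nonneg[of s] by (cases "p s = 0") auto
    have "norm v \<le> (1 / p s) * p v" for v
    proof (cases "v = 0")
      case False
      have "p s \<le> p ((1 / norm v) *\<^sub>R v)" by (rule s(2)) (use False in simp)
      then show ?thesis using False ps by (simp add: scale field_simps)
    qed (simp add: props(1))
    then show ?thesis using ps by (intro exI[of _ "1 / p s"]) auto
  qed
  then show thesis using that c upper by blast
qed

text \<open>The norm \<open>p\<close> is equivalent to the Euclidean one. Hence \<open>P\<close> restricted to \<open>W\<close> has a Lipschitz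
  inverse, and \<open>W\<close> is a Lipschitz image of a subset of the proper subspace \<open>range P\<close>.\<close>

lemma negligible_Lipschitz_graph:
  fixes P :: "'b::euclidean_space \<Rightarrow> 'b"
  assumes p: "is_norm_on UNIV p" and P: "linear P" "range P \<noteq> UNIV"
    and W: "\<And>u v. u \<in> W \<Longrightarrow> v \<in> W \<Longrightarrow> p (u - v) \<le> p (P (u - v))"
  shows "negligible W"
proof -
  obtain c C where c: "c > 0" "\<And>v. p v \<le> c * norm v" and C: "C > 0" "\<And>v. norm v \<le> C * p v"
    using norm_on_equivalent[OF p] by metis
  have Lip: "norm (u - v) \<le> (C * c) * norm (P u - P v)" if "u \<in> W" "v \<in> W" for u v
  proof -
    have "norm (u - v) \<le> C * p (u - v)" by (rule C(2))
    also have "\<dots> \<le> C * (c * norm (P (u - v)))"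
      using W[OF that] c(2)[of "P (u - v)"] C(1) by (intro mult_left_mono) auto
    finally show ?thesis by (simp add: linear_diff[OF P(1)])
  qed
  then have inj: "inj_on P W"
    by (fastforce intro: inj_onI)
  have "subspace (range P)" by (rule linear_subspace_image[OF P(1) subspace_UNIV])
  then have "dim (range P) < DIM('b)"
    using P(2) by (metis dim_eq_full dim_subset_UNIV order_le_neq_trans span_eq_iff)
  then have "negligible (range P)" by (rule negligible_lowdim)
  then have "negligible (P ` W)" by (rule negligible_subset) auto
  then have "negligible (inv_into W P ` (P ` W))"
  proof (rule negligible_locally_Lipschitz_image[rotated])
    fix x assume "x \<in> P ` W"
    then show "\<exists>T B. open T \<and> x \<in> T \<and>
        (\<forall>y\<in>P ` W \<inter> T. norm (inv_into W P y - inv_into W P x) \<le> B * norm (y - x))"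
      using Lip inj by (intro exI[of _ UNIV] exI[of _ "C * c"]) auto
  qed simp
  then show ?thesis using inj by (simp add: image_image)
qed

section \<open>Expansion of the unstable cone\<close>

text \<open>Expressing the max-norm \<open>N\<close> through itself and \<open>P\<close> allows the cone argument below to forget
  the norms of the two factors.\<close>

lemma splitting_projection:
  assumes s: "splitting X Ecs Eu" and cs: "is_norm_on Ecs Ncs" and u: "is_norm_on Eu Nu"
  defines "N \<equiv> max_norm Ecs Ncs Eu Nu"
  obtains P where "linear_self_map X P" "\<And>x. x \<in> X \<Longrightarrow> P x \<in> Ecs" "\<And>x. x \<in> X \<Longrightarrow> x - P x \<in> Eu"
    "\<And>y z. y \<in> Ecs \<Longrightarrow> z \<in> Eu \<Longrightarrow> P (y + z) = y" "is_norm_on X N"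
    "\<And>x. x \<in> X \<Longrightarrow> N x = max (N (P x)) (N (x - P x))"
proof -
  have sub: "subspace Ecs" "subspace Eu" and X: "X = {y + z |y z. y \<in> Ecs \<and> z \<in> Eu}"
    and int: "Ecs \<inter> Eu = {0}"
    using s by (auto simp: splitting_def)
  have uniq: "y = y' \<and> z = z'" if "y \<in> Ecs" "z \<in> Eu" "y' \<in> Ecs" "z' \<in> Eu" "y + z = y' + z'" for y z y' z'
  proof -
    have eq: "y - y' = z' - z" using that(5) by (simp add: algebra_simps)
    have "y - y' \<in> Ecs" "z' - z \<in> Eu"
      using that sub by (auto intro: subspace_diff)
    then have "y - y' \<in> Ecs \<inter> Eu" unfolding eq by simp
    then show ?thesis using int eq by auto
  qed
  define P where "P x = (THE y. y \<in> Ecs \<and> x - y \<in> Eu)" for x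
  have P: "P (y + z) = y" if "y \<in> Ecs" "z \<in> Eu" for y z
    unfolding P_def
  proof (rule the_equality)
    show "y \<in> Ecs \<and> y + z - y \<in> Eu" using that by simp
    fix y' assume "y' \<in> Ecs \<and> y + z - y' \<in> Eu"
    then show "y' = y" using uniq[of y z y' "y + z - y'"] that by simp
  qed
  have N: "N (y + z) = max (Ncs y) (Nu z)" if "y \<in> Ecs" "z \<in> Eu" for y z
    unfolding N_def max_norm_def
  proof (rule the_equality)
    show "\<exists>y'\<in>Ecs. \<exists>z'\<in>Eu. y + z = y' + z' \<and> max (Ncs y) (Nu z) = max (Ncs y') (Nu z')"
      using that by blast
    fix m assume "\<exists>y'\<in>Ecs. \<exists>z'\<in>Eu. y + z = y' + z' \<and> m = max (Ncs y') (Nu z')"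
    then show "m = max (Ncs y) (Nu z)" using uniq that by blast
  qed
  have zero: "Ncs 0 = 0" "Nu 0 = 0"
    using norm_on_properties(1) cs u sub by auto
  have nonneg: "y \<in> Ecs \<Longrightarrow> 0 \<le> Ncs y" "z \<in> Eu \<Longrightarrow> 0 \<le> Nu z" for y z
    using cs u by (auto simp: is_norm_on_def)
  have Ny: "N y = Ncs y" if "y \<in> Ecs" for y
    using N[of y 0] that nonneg zero sub by (simp add: subspace_0)
  have Nz: "N z = Nu z" if "z \<in> Eu" for z
    using N[of 0 z] that nonneg zero sub by (simp add: subspace_0)
  have decomp: thesis if "x \<in> X" "\<And>y z. y \<in> Ecs \<Longrightarrow> z \<in> Eu \<Longrightarrow> x = y + z \<Longrightarrow> thesis" for x thesis
    using that X by blast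
  have add: "(y + z) + (y' + z') = (y + y') + (z + z')" for y z y' z' :: 'a by simp
  show thesis
  proof
    show Pcs: "P x \<in> Ecs" if "x \<in> X" for x using that by (elim decomp) (simp add: P)
    show "x - P x \<in> Eu" if "x \<in> X" for x using that by (elim decomp) (simp add: P)
    show "P (y + z) = y" if "y \<in> Ecs" "z \<in> Eu" for y z using P that .
    show "N x = max (N (P x)) (N (x - P x))" if "x \<in> X" for x
      using that by (elim decomp) (simp add: P N Ny Nz)
    show "linear_self_map X P"
      unfolding linear_self_map_def
    proof (intro conjI ballI allI)
      show "P \<in> X \<rightarrow> X"
      proof
        fix x assume "x \<in> X"
        then have "P x \<in> Ecs" by (rule Pcs)
        moreover have "P x = P x + 0" by simp
        ultimately show "P x \<in> X" using subspace_0[OF sub(2)] unfolding X by blast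
      qed
      fix v assume v: "v \<in> X"
      show "P (v + w) = P v + P w" if "w \<in> X" for w
        using v that by (elim decomp) (simp add: add P subspace_add[OF sub(1)] subspace_add[OF sub(2)])
      show "P (c *\<^sub>R v) = c *\<^sub>R P v" for c
        using v by (elim decomp)
          (simp add: scaleR_add_right P subspace_scale[OF sub(1)] subspace_scale[OF sub(2)])
    qed
    show "is_norm_on X N"
      unfolding is_norm_on_def
    proof (intro conjI ballI allI)
      fix v assume v: "v \<in> X"
      show "0 \<le> N v" using v by (elim decomp) (simp add: N nonneg max.coboundedI1)
      show "N v = 0 \<longleftrightarrow> v = 0"
      proof -
        obtain y z where yz: "y \<in> Ecs" "z \<in> Eu" "v = y + z" using v decomp by blast
        have "N v = 0 \<longleftrightarrow> Ncs y = 0 \<and> Nu z = 0"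
          using nonneg(1)[OF yz(1)] nonneg(2)[OF yz(2)] N[OF yz(1,2)] yz(3) by (auto simp: max_def)
        also have "\<dots> \<longleftrightarrow> y = 0 \<and> z = 0" using cs u yz by (auto simp: is_norm_on_def)
        also have "\<dots> \<longleftrightarrow> v = 0"
          using uniq[of y z 0 0] yz sub by (auto simp: subspace_0)
        finally show ?thesis .
      qed
      show "N (c *\<^sub>R v) = \<bar>c\<bar> * N v" for c
      proof -
        obtain y z where yz: "y \<in> Ecs" "z \<in> Eu" "v = y + z" using v decomp by blast
        have "N (c *\<^sub>R v) = max (Ncs (c *\<^sub>R y)) (Nu (c *\<^sub>R z))"
          using yz N sub by (simp add: scaleR_add_right subspace_scale)
        also have "\<dots> = max (\<bar>c\<bar> * Ncs y) (\<bar>c\<bar> * Nu z)" using cs u yz by (simp add: is_norm_on_def)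
        finally show ?thesis using yz N by (simp add: max_mult_distrib_left)
      qed
      show "N (v + w) \<le> N v + N w" if w: "w \<in> X" for w
      proof -
        obtain y z where yz: "y \<in> Ecs" "z \<in> Eu" "v = y + z" using v decomp by blast
        obtain y' z' where yz': "y' \<in> Ecs" "z' \<in> Eu" "w = y' + z'" using w decomp by blast
        have "N (v + w) = max (Ncs (y + y')) (Nu (z + z'))"
          using N[of "y + y'" "z + z'"] yz yz' sub by (simp add: add subspace_add)
        moreover have "Ncs (y + y') \<le> Ncs y + Ncs y'" "Nu (z + z') \<le> Nu z + Nu z'"
          using cs u yz yz' by (auto simp: is_norm_on_def)
        ultimately show ?thesis using yz yz' N by (simp add: max_def)
      qed
    qed
  qed
qed

lemma Lip_le_imp_bound:
  assumes "Lip N h U \<le> ennreal e" "0 < e" "u \<in> U" "v \<in> U" "u \<noteq> v" "0 < N (u - v)"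
  shows "N (h u - h v) \<le> e * N (u - v)"
proof -
  have "ennreal (N (h u - h v) / N (u - v)) \<le> Lip N h U"
    unfolding Lip_def using assms by (intro SUP_upper2[of "(u, v)"]) auto
  with assms(1) have "ennreal (N (h u - h v) / N (u - v)) \<le> ennreal e" by order
  with assms have "N (h u - h v) / N (u - v) \<le> e" by (simp add: ennreal_le_iff)
  with assms show ?thesis by (simp add: field_simps)
qed

text \<open>A difference in the unstable cone \<open>N (P w) \<le> N (w - P w)\<close> has norm \<open>N (w - P w)\<close>. The linear
  part stretches this component by at least \<open>\<mu>\<close> and the other one by at most \<open>\<nu>\<close>; the nonlinear
  error \<open>\<epsilon> * N w\<close> is too small to close the gap between the two rates.\<close>

lemma unstable_cone_step:
  assumes X: "subspace X" and N: "is_norm_on X N" and Ndef: "N = max_norm Ecs Ncs Eu Nu"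
    and P: "linear_self_map X P" "\<And>x. x \<in> X \<Longrightarrow> P x \<in> Ecs" "\<And>x. x \<in> X \<Longrightarrow> x - P x \<in> Eu"
      "\<And>y z. y \<in> Ecs \<Longrightarrow> z \<in> Eu \<Longrightarrow> P (y + z) = y"
      "\<And>x. x \<in> X \<Longrightarrow> N x = max (N (P x)) (N (x - P x))"
    and T: "linear_self_map X T" and g: "g \<in> X \<rightarrow> X"
    and PH: "PH g T \<mu> \<nu> \<epsilon> U Ecs Ncs Eu Nu"
    and uv: "U \<subseteq> X" "u \<in> U" "v \<in> U"
    and cone: "N (P (u - v)) \<le> N ((u - v) - P (u - v))"
  defines "w' \<equiv> g u - g v"
  shows "N (P w') \<le> N (w' - P w')" and "(\<mu> - \<epsilon>) * N (u - v) \<le> N w'"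
proof -
  have rates: "0 \<le> \<nu>" "0 < \<epsilon>" "\<nu> + \<epsilon> \<le> \<mu> - \<epsilon>"
    and inv: "T ` Ecs \<subseteq> Ecs" "T ` Eu \<subseteq> Eu"
    and Tcs: "\<And>y. y \<in> Ecs \<Longrightarrow> N (T y) \<le> \<nu> * N y" and Tu: "\<And>z. z \<in> Eu \<Longrightarrow> \<mu> * N z \<le> N (T z)"
    and Lip: "Lip N (\<lambda>x. g x - T x) U \<le> ennreal \<epsilon>"
    using PH by (simp_all add: PH_def Let_def Ndef)
  note props = norm_on_properties[OF N X]
  have tri: "N (a + b) \<le> N a + N b" if "a \<in> X" "b \<in> X" for a b
    using N that by (auto simp: is_norm_on_def)
  have nonneg: "0 \<le> N a" if "a \<in> X" for a
    using N that by (auto simp: is_norm_on_def)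
  define w where "w = u - v"
  define h where "h = (g u - T u) - (g v - T v)"
  have mem: "u \<in> X" "v \<in> X" "g u \<in> X" "g v \<in> X" "T u \<in> X" "T v \<in> X"
    using uv g T by (auto simp: linear_self_map_def Pi_iff)
  have w: "w \<in> X" and h: "h \<in> X" and w': "w' \<in> X"
    unfolding w_def h_def w'_def using mem by (auto intro!: subspace_diff[OF X])
  have Pmem: "P a \<in> X" "a - P a \<in> X" if "a \<in> X" for a
    using that P(1) by (auto simp: linear_self_map_def Pi_iff intro!: subspace_diff[OF X])
  have Tmem: "T a \<in> X" if "a \<in> X" for a
    using that T by (auto simp: linear_self_map_def)
  have Tadd: "T (a + b) = T a + T b" if "a \<in> X" "b \<in> X" for a b
    using that T by (auto simp: linear_self_map_def)
  have Padd: "P (a + b) = P a + P b" if "a \<in> X" "b \<in> X" for a b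
    using that P(1) by (auto simp: linear_self_map_def)
  have Tw: "T u = T w + T v" using Tadd[of w v] w mem by (simp add: w_def)
  have w'_eq: "w' = T w + h" unfolding w'_def h_def using Tw by simp
  have Tsplit: "T w = T (P w) + T (w - P w)"
    using Tadd[of "P w" "w - P w"] Pmem w by simp
  have "T (P w) \<in> Ecs" "T (w - P w) \<in> Eu"
    using inv P(2)[OF w] P(3)[OF w] by auto
  then have PT: "P (T w) = T (P w)" unfolding Tsplit by (rule P(4))
  have Pw': "P w' = T (P w) + P h" using Padd[OF Tmem[OF w] h] by (simp add: w'_eq PT)
  have Qw': "w' - P w' = T (w - P w) + (h - P h)"
    unfolding Pw' using w'_eq Tsplit by simp
  have Nw: "N w = N (w - P w)" using P(5)[OF w] cone by (simp add: w_def)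
  have hb: "N h \<le> \<epsilon> * N w"
  proof (cases "u = v")
    case True
    then show ?thesis by (simp add: h_def w_def props(1))
  next
    case False
    then have "0 < N w" using N w nonneg[OF w] unfolding is_norm_on_def w_def
      by (metis order_le_less right_minus_eq)
    then show ?thesis
      using Lip_le_imp_bound[OF Lip rates(2) uv(2,3) False]
      by (simp add: h_def w_def)
  qed
  have Ph: "N (P h) \<le> N h" "N (h - P h) \<le> N h" using P(5)[OF h] by auto
  have cs: "N (P w') \<le> (\<nu> + \<epsilon>) * N w"
  proof -
    have "N (P w') \<le> N (T (P w)) + N (P h)"
      unfolding Pw' by (intro tri Pmem Tmem w h)
    also have "\<dots> \<le> \<nu> * N (P w) + \<epsilon> * N w"
      using Tcs[OF P(2)[OF w]] Ph(1) hb by linarith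
    also have "\<dots> \<le> \<nu> * N w + \<epsilon> * N w"
      using mult_left_mono[of "N (P w)" "N w" \<nu>] cone Nw rates(1) by (simp add: w_def)
    finally show ?thesis by (simp add: algebra_simps)
  qed
  have un: "(\<mu> - \<epsilon>) * N w \<le> N (w' - P w')"
  proof -
    have "(\<mu> - \<epsilon>) * N w = \<mu> * N (w - P w) - \<epsilon> * N w" by (simp add: Nw algebra_simps)
    also have "\<dots> \<le> N (T (w - P w)) - N (h - P h)"
      using Tu[OF P(3)[OF w]] Ph(2) hb by linarith
    also have "\<dots> \<le> N (w' - P w')"
      unfolding Qw' by (intro props(4) Pmem Tmem w h)
    finally show ?thesis .
  qed
  have "(\<nu> + \<epsilon>) * N w \<le> (\<mu> - \<epsilon>) * N w"
    using rates(3) nonneg[OF w] by (rule mult_right_mono)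
  with cs un show "N (P w') \<le> N (w' - P w')" by linarith
  show "(\<mu> - \<epsilon>) * N (u - v) \<le> N w'"
    using un P(5)[OF w'] by (simp add: w_def)
qed

text \<open>The product of the growth factors dominates \<open>1 + (\<Sum>i<j. e i)\<close>, which is unbounded.\<close>

lemma bounded_growth_imp_zero:
  fixes d e :: "nat \<Rightarrow> real"
  assumes pos: "\<And>j. 0 \<le> d j" "\<And>j. 0 \<le> e j"
    and growth: "\<And>j. (1 + e j) * d j \<le> d (Suc j)"
    and bound: "\<And>j. d j \<le> B"
    and div: "filterlim (\<lambda>n. \<Sum>j<n. e j) at_top sequentially"
  shows "d 0 = 0"
proof (rule ccontr)
  assume "d 0 \<noteq> 0"
  with pos(1)[of 0] have d0: "d 0 > 0" by simp
  have mono: "d 0 \<le> d j" for j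
  proof (induction j)
    case (Suc j)
    have "0 \<le> e j * d j" using pos by simp
    with Suc growth[of j] show ?case by (simp add: algebra_simps)
  qed simp
  have lower: "(1 + (\<Sum>i<j. e i)) * d 0 \<le> d j" for j
  proof (induction j)
    case (Suc j)
    have "e j * d 0 \<le> e j * d j" using mono pos by (intro mult_left_mono) auto
    with Suc growth[of j] show ?case by (simp add: algebra_simps)
  qed simp
  obtain n where "B / d 0 \<le> (\<Sum>i<n. e i)"
    using div unfolding filterlim_at_top by (meson eventually_happens trivial_limit_sequentially)
  then have "B < (1 + (\<Sum>i<n. e i)) * d 0"
    using d0 by (simp add: field_simps)
  with lower[of n] bound[of n] show False by linarith
qed

definition trapped :: "(nat \<Rightarrow> 'a \<Rightarrow> 'a) \<Rightarrow> 'a set \<Rightarrow> nat \<Rightarrow> 'a set" where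
  "trapped g S n = {x. \<forall>j. trajectory (\<lambda>i. g (n + i)) x j \<in> S}"

lemma trapped_subset: "trapped g S n \<subseteq> S"
proof
  fix x assume "x \<in> trapped g S n"
  then have "trajectory (\<lambda>i. g (n + i)) x 0 \<in> S" unfolding trapped_def by blast
  then show "x \<in> S" by simp
qed

text \<open>Two trapped orbits whose initial difference violates the conclusion differ by a vector of the
  unstable cone, and their distance would grow by the factors \<open>1 + \<epsilon> k\<close> beyond the diameter of the
  ball. The vector \<open>z\<close> records that the unstable space is nontrivial, that is, that \<open>P\<close> is not onto.\<close>

lemma NPH_trapped_orbits:
  fixes X :: "'v::real_vector set"
  assumes X: "subspace X" and gX: "\<And>k. g k \<in> X \<rightarrow> X" and NPH: "NPH_unstable_origin X g"
  obtains N P r K z where "is_norm_on X N" "linear_self_map X P" "z \<in> X" "z \<notin> P ` X" "r > 0"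
    "\<forall>n\<ge>K. \<forall>u\<in>trapped g (norm_ball X N r) n. \<forall>v\<in>trapped g (norm_ball X N r) n.
       N (u - v) \<le> N (P (u - v))"
proof -
  obtain Ecs Eu Ncs Nu T r K \<mu> \<nu> \<epsilon> where s: "splitting X Ecs Eu" and dim: "dim Eu \<ge> 1"
    and cs: "is_norm_on Ecs Ncs" and u: "is_norm_on Eu Nu"
    and T': "\<forall>k. linear_self_map X (T k)" and r: "r > (0::real)"
    and pos': "\<forall>k\<ge>K. \<mu> k > (0::real) \<and> \<nu> k > (0::real) \<and> \<epsilon> k > (0::real)"
    and PH': "\<forall>k\<ge>K. PH (g k) (T k) (\<mu> k) (\<nu> k) (\<epsilon> k / 4)
       (norm_ball X (max_norm Ecs Ncs Eu Nu) r) Ecs Ncs Eu Nu"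
    and gap': "\<forall>k\<ge>K. \<epsilon> k < (\<mu> k - \<nu> k) / 4"
    and div: "filterlim (\<lambda>n. \<Sum>k=K..<n. \<epsilon> k / (\<mu> k - 2 * \<epsilon> k)) at_top sequentially"
    using NPH unfolding NPH_unstable_origin_def by (elim conjE exE) (rule that)
  note T = T'[rule_format] and pos = pos'[rule_format] and PH = PH'[rule_format]
    and gap = gap'[rule_format]
  define N where "N = max_norm Ecs Ncs Eu Nu"
  obtain P where P: "linear_self_map X P" "\<And>x. x \<in> X \<Longrightarrow> P x \<in> Ecs" "\<And>x. x \<in> X \<Longrightarrow> x - P x \<in> Eu"
      "\<And>y z. y \<in> Ecs \<Longrightarrow> z \<in> Eu \<Longrightarrow> P (y + z) = y" "is_norm_on X N"
      "\<And>x. x \<in> X \<Longrightarrow> N x = max (N (P x)) (N (x - P x))"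
    using splitting_projection[OF s cs u, folded N_def] by blast
  have nu: "\<nu> k \<ge> 1" if "k \<ge> K" for k
    using PH[OF that] by (simp add: PH_def Let_def)
  have sub: "subspace Ecs" "subspace Eu" "X = {y + z |y z. y \<in> Ecs \<and> z \<in> Eu}" "Ecs \<inter> Eu = {0}"
    using s by (auto simp: splitting_def)
  have "dim {0::'v} = 0" using real_vector.dim_eq_card[of "{}" "{0::'v}"] real_vector.independent_empty
    by simp
  then have "Eu \<noteq> {0}" using dim by auto
  then obtain z where z: "z \<in> Eu" "z \<noteq> 0" using subspace_0[OF sub(2)] by blast
  have zX: "z \<in> X"
  proof -
    have "z = 0 + z" by simp
    then show ?thesis unfolding sub(3) using z(1) subspace_0[OF sub(1)] by blast
  qed
  have znot: "z \<notin> P ` X"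
  proof
    assume "z \<in> P ` X"
    then have "z \<in> Ecs" using P(2) by blast
    with z sub(4) show False by blast
  qed
  have main: "N (u - v) \<le> N (P (u - v))"
    if n: "n \<ge> K" and uv: "u \<in> trapped g (norm_ball X N r) n" "v \<in> trapped g (norm_ball X N r) n"
    for n u v
  proof (rule ccontr)
    assume not: "\<not> ?thesis"
    define w where "w j = trajectory (\<lambda>i. g (n + i)) u j - trajectory (\<lambda>i. g (n + i)) v j" for j
    have tu: "trajectory (\<lambda>i. g (n + i)) u j \<in> norm_ball X N r"
      and tv: "trajectory (\<lambda>i. g (n + i)) v j \<in> norm_ball X N r" for j
      using uv by (auto simp: trapped_def)
    have ball: "norm_ball X N r \<subseteq> X" by (auto simp: norm_ball_def)
    have wX: "w j \<in> X" for j
      unfolding w_def using tu tv ball subspace_diff[OF X] by blast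
    have w0: "w 0 = u - v" by (simp add: w_def)
    have step: "N (P (w (Suc j))) \<le> N (w (Suc j) - P (w (Suc j))) \<and>
        (\<mu> (n + j) - \<epsilon> (n + j) / 4) * N (w j) \<le> N (w (Suc j))"
      if "N (P (w j)) \<le> N (w j - P (w j))" for j
      using unstable_cone_step[OF X P(5) N_def P(1-4,6) T gX PH[folded N_def] ball tu[of j] tv[of j], of "n + j"]
        that n by (simp add: w_def)
    have cone: "N (P (w j)) \<le> N (w j - P (w j))" for j
    proof (induction j)
      case 0
      show ?case using not P(6)[OF wX[of 0]] by (simp add: w0 max_def split: if_splits)
    qed (use step in blast)
    have nonneg: "0 \<le> N (w j)" for j using P(5) wX by (auto simp: is_norm_on_def)
    have "N (w 0) = 0"
    proof (rule bounded_growth_imp_zero)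
      show "0 \<le> N (w j)" for j by (rule nonneg)
      show "0 \<le> \<epsilon> (n + j)" for j using pos[of "n + j"] n by simp
      show "(1 + \<epsilon> (n + j)) * N (w j) \<le> N (w (Suc j))" for j
      proof -
        \<comment> \<open>\<open>\<nu> \<ge> 1\<close> and \<open>\<mu> - \<nu> > 4 * \<epsilon>\<close> leave room for the error \<open>\<epsilon> / 4\<close> of the nonlinear part.\<close>
        have "1 + \<epsilon> (n + j) \<le> \<mu> (n + j) - \<epsilon> (n + j) / 4"
          using gap[of "n + j"] nu[of "n + j"] pos[of "n + j"] n by simp
        then have "(1 + \<epsilon> (n + j)) * N (w j) \<le> (\<mu> (n + j) - \<epsilon> (n + j) / 4) * N (w j)"
          using nonneg by (rule mult_right_mono)
        also have "\<dots> \<le> N (w (Suc j))" using step cone by blast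
        finally show ?thesis .
      qed
      show "N (w j) \<le> 2 * r" for j
        unfolding w_def
        using norm_on_properties(3)[OF P(5) X] tu[of j] tv[of j] by (force simp: norm_ball_def)
      show "filterlim (\<lambda>m. \<Sum>j<m. \<epsilon> (n + j)) at_top sequentially"
      proof -
        \<comment> \<open>The denominators of the given divergent series are at least 1, so \<open>\<Sum>\<epsilon>\<close> dominates it; the
          finitely many terms before time \<open>n\<close> do not affect divergence.\<close>
        let ?q = "\<lambda>k. \<epsilon> k / (\<mu> k - 2 * \<epsilon> k)"
        have "filterlim (\<lambda>m. - (\<Sum>k=K..<n. ?q k) + (\<Sum>k=K..<m + n. ?q k)) at_top sequentially"
          by (intro filterlim_tendsto_add_at_top[OF tendsto_const]
              filterlim_compose[OF div] filterlim_add_const_nat_at_top)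
        then show ?thesis
        proof (rule filterlim_at_top_mono, intro always_eventually allI)
          fix m
          have "(\<Sum>k=K..<m + n. ?q k) = (\<Sum>k=K..<n. ?q k) + (\<Sum>k=n..<m + n. ?q k)"
            using n by (intro sum.atLeastLessThan_concat[symmetric]) auto
          then have "- (\<Sum>k=K..<n. ?q k) + (\<Sum>k=K..<m + n. ?q k) = (\<Sum>k=n..<m + n. ?q k)" by simp
          also have "\<dots> = (\<Sum>j<m. ?q (n + j))"
            using sum.shift_bounds_nat_ivl[of ?q 0 n m]
            by (simp add: atLeast0LessThan add.commute)
          also have "\<dots> \<le> (\<Sum>j<m. \<epsilon> (n + j))"
          proof (rule sum_mono)
            fix j
            have "1 \<le> \<mu> (n + j) - 2 * \<epsilon> (n + j)" "0 < \<epsilon> (n + j)"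
              using gap[of "n + j"] nu[of "n + j"] pos[of "n + j"] n by auto
            then show "?q (n + j) \<le> \<epsilon> (n + j)"
              by (simp add: divide_le_eq mult_left_le mult_le_cancel_left1)
          qed
          finally show "- (\<Sum>k=K..<n. ?q k) + (\<Sum>k=K..<m + n. ?q k) \<le> (\<Sum>j<m. \<epsilon> (n + j))" .
        qed
      qed
    qed
    then have "u - v = 0" using P(5) wX[of 0] by (simp add: is_norm_on_def w0)
    then have "N (u - v) = 0" by (simp add: norm_on_properties(1)[OF P(5) X])
    moreover have "P (u - v) \<in> X" using P(1) wX[of 0] by (auto simp: linear_self_map_def w0)
    then have "0 \<le> N (P (u - v))" using P(5) by (auto simp: is_norm_on_def)
    ultimately show False using not by simp
  qed
  show thesis using main by (intro that[OF P(5) P(1) zX znot r]) blast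
qed


section \<open>Null sets on a manifold\<close>

lemma smooth_on_imp_differentiable_on: "smooth_on S f \<Longrightarrow> f differentiable_on S"
  unfolding smooth_on_def
  by (drule spec[of _ "Suc 0"]) (auto intro: differentiable_at_imp_differentiable_on)

lemma smooth_on_imp_continuous_on: "smooth_on S f \<Longrightarrow> continuous_on S f"
  unfolding smooth_on_def by (drule spec[of _ 0]) simp

lemma measure_zero_iff_negligible:
  "measure_zero \<A> S \<longleftrightarrow> (\<forall>(U, \<phi>)\<in>\<A>. negligible (\<phi> ` (S \<inter> U)))"
  by (simp add: measure_zero_def negligible_iff_null_sets)

lemma measure_zero_subset:
  assumes "measure_zero \<A> T" "S \<subseteq> T"
  shows "measure_zero \<A> S"
  using assms unfolding measure_zero_iff_negligible
  by (blast intro: negligible_subset[OF _ image_mono])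

lemma measure_zero_UN:
  assumes "countable I" "\<And>i. i \<in> I \<Longrightarrow> measure_zero \<A> (S i)"
  shows "measure_zero \<A> (\<Union>i\<in>I. S i)"
  unfolding measure_zero_iff_negligible
proof clarify
  fix U \<phi> assume "(U, \<phi>) \<in> \<A>"
  then have "negligible (\<phi> ` (S i \<inter> U))" if "i \<in> I" for i
    using assms(2)[OF that] by (auto simp: measure_zero_iff_negligible)
  then have "negligible (\<Union> ((\<lambda>i. \<phi> ` (S i \<inter> U)) ` I))"
    using assms(1) by (intro negligible_countable_Union) auto
  also have "\<Union> ((\<lambda>i. \<phi> ` (S i \<inter> U)) ` I) = \<phi> ` ((\<Union>i\<in>I. S i) \<inter> U)" by auto
  finally show "negligible (\<phi> ` ((\<Union>i\<in>I. S i) \<inter> U))" .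
qed

text \<open>Transition maps are differentiable and hence preserve null sets.\<close>

lemma measure_zero_in_chart:
  assumes atlas: "smooth_atlas \<A>" and chart: "(V, \<kappa>) \<in> \<A>" "C \<subseteq> V" and null: "negligible (\<kappa> ` C)"
  shows "measure_zero \<A> C"
  unfolding measure_zero_iff_negligible
proof clarify
  fix U \<phi> assume U: "(U, \<phi>) \<in> \<A>"
  have "smoothly_compatible (V, \<kappa>) (U, \<phi>)" and "is_chart (V, \<kappa>)"
    using atlas chart(1) U unfolding smooth_atlas_def by blast+
  then have smooth: "smooth_on (\<kappa> ` (V \<inter> U)) (\<phi> \<circ> inv_into V \<kappa>)"
    and inv: "\<And>p. p \<in> V \<Longrightarrow> inv_into V \<kappa> (\<kappa> p) = p"
    by (auto simp: smoothly_compatible_def is_chart_def homeomorphism_def)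
  have "negligible ((\<phi> \<circ> inv_into V \<kappa>) ` (\<kappa> ` (C \<inter> U)))"
  proof (rule negligible_differentiable_image_negligible)
    show "negligible (\<kappa> ` (C \<inter> U))" using null by (rule negligible_subset) auto
    show "(\<phi> \<circ> inv_into V \<kappa>) differentiable_on \<kappa> ` (C \<inter> U)"
      using smooth_on_imp_differentiable_on[OF smooth] chart(2)
      by (auto intro: differentiable_on_subset)
  qed simp
  moreover have "(\<phi> \<circ> inv_into V \<kappa>) ` (\<kappa> ` (C \<inter> U)) = \<phi> ` (C \<inter> U)"
    unfolding image_image using inv chart(2) by (intro image_cong) auto
  ultimately show "negligible (\<phi> ` (C \<inter> U))" by simp
qed

lemma trajectory_add:
  "trajectory g x (n + j) = trajectory (\<lambda>i. g (n + i)) (trajectory g x n) j"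
  by (induction j) auto

lemma measure_zero_trajectory_preimage:
  assumes luzin: "\<And>k. luzin_N_inverse \<A> (g k)" and E: "measure_zero \<A> E"
  shows "measure_zero \<A> {x. trajectory g x n \<in> E}"
  using E
proof (induction n arbitrary: E)
  case (Suc n)
  then have "measure_zero \<A> (g n -` E)" using luzin by (auto simp: luzin_N_inverse_def)
  from Suc.IH[OF this] show ?case by simp
qed simp

section \<open>Trapped orbits near an unstable fixed point\<close>

lemma linear_chartsE:
  assumes "(V, \<kappa>) \<in> linear_charts X"
  obtains L W where "linear L" "open W" "V = L ` W" "\<kappa> = inv L" "range L = X"
    "\<And>v. inv L (L v) = v" "\<And>x. x \<in> X \<Longrightarrow> L (inv L x) = x"
proof -
  obtain L W where L: "linear L" "bij_betw L UNIV X" "open W" "V = L ` W" "\<kappa> = inv L"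
    using assms unfolding linear_charts_def by auto
  then have "inj L" "range L = X" by (auto simp: bij_betw_def)
  with L show thesis by (intro that[of L W]) (auto simp: f_inv_into_f)
qed

text \<open>The map \<open>inv L\<close> itself is linear only on \<open>range L\<close>.\<close>

lemma linear_inv_comp:
  assumes L: "linear L" "\<And>v. inv L (L v) = v" and M: "linear M" "range M \<subseteq> range L"
  shows "linear (inv L \<circ> M)"
proof -
  have M_eq: "L (inv L (M v)) = M v" for v
    using M(2) by (intro f_inv_into_f) blast
  have inj: "u = v" if "L u = L v" for u v using that L(2) by metis
  show ?thesis
  proof (rule linearI)
    show "(inv L \<circ> M) (u + v) = (inv L \<circ> M) u + (inv L \<circ> M) v" for u v
      by (rule inj) (use M_eq[of "u + v"] in \<open>simp add: M_eq linear_add[OF L(1)] linear_add[OF M(1)]\<close>)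
    show "(inv L \<circ> M) (c *\<^sub>R v) = c *\<^sub>R (inv L \<circ> M) v" for c v
      by (rule inj) (use M_eq[of "c *\<^sub>R v"] in \<open>simp add: M_eq linear_scale[OF L(1)] linear_scale[OF M(1)]\<close>)
  qed
qed

text \<open>The null set of trapped points lives in the coordinates \<open>L1\<close> of the tangent space. Choosing \<open>Q\<close>
  so small that \<open>\<psi>'\<close> maps it into the domain of one chart in which \<open>\<psi>\<close> is smooth, the points trapped
  in \<open>Q\<close> are covered by the smooth image under \<open>\<psi>\<close> of a null set in this chart.\<close>

lemma NPH_neighbourhood:
  fixes \<A> :: "('a::{t2_space, second_countable_topology}, 'b::euclidean_space) chart set"
  assumes atlas: "smooth_atlas \<A>" and x: "NPH_unstable_fixed_point \<A> g x"
  obtains Q K where "open Q" "x \<in> Q"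
    "\<And>n. n \<ge> K \<Longrightarrow> measure_zero \<A> (trapped g Q n)"
proof -
  define X where "X = tangent_space \<A> x"
  obtain \<psi> \<psi>' U V U0 where psi': "\<psi>' \<in> UNIV \<rightarrow> X"
    and smooth: "smooth_map (linear_charts X :: (_, 'b) chart set) \<A> \<psi>"
      "smooth_map \<A> (linear_charts X :: (_, 'b) chart set) \<psi>'"
    and U0: "open U0" "x \<in> U0" "U0 \<subseteq> U"
    and V: "\<exists>(V0, \<kappa>0)\<in>(linear_charts X :: (_, 'b) chart set). 0 \<in> V0 \<and> V0 \<subseteq> V"
    and psi0: "\<psi> 0 = x" and inv: "\<forall>v\<in>V. \<psi>' (\<psi> v) = v" "\<forall>u\<in>U. \<psi> (\<psi>' u) = u"
    and NPH: "NPH_unstable_origin X (\<lambda>k. \<psi>' \<circ> g k \<circ> \<psi>)"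
    using x unfolding NPH_unstable_fixed_point_def Let_def X_def[symmetric]
    by (elim conjE exE) (rule that)
  obtain V0 \<kappa>0 where V0: "(V0, \<kappa>0) \<in> (linear_charts X :: (_, 'b) chart set)" "0 \<in> V0" "V0 \<subseteq> V"
    using V by blast
  have psi'_X: "\<psi>' q \<in> X" for q using psi' by auto
  have "x \<in> \<Union> (fst ` \<A>)" using atlas by (simp add: smooth_atlas_def)
  then obtain Ux \<phi> V2 \<kappa>2 where Ux: "(Ux, \<phi>) \<in> \<A>" "x \<in> Ux"
    and V2: "(V2, \<kappa>2) \<in> (linear_charts X :: (_, 'b) chart set)"
    and s2: "smooth_on (\<phi> ` Ux) (\<kappa>2 \<circ> \<psi>' \<circ> inv_into Ux \<phi>)"
    using smooth(2) unfolding smooth_map_def by blast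
  have "0 \<in> \<Union> (fst ` (linear_charts X :: (_, 'b) chart set))" using V0 by force
  then obtain V1 \<kappa>1 V3 \<kappa>3 where V1: "(V1, \<kappa>1) \<in> (linear_charts X :: (_, 'b) chart set)" "0 \<in> V1"
    and V3: "(V3, \<kappa>3) \<in> \<A>" "\<psi> ` V1 \<subseteq> V3"
    and s1: "smooth_on (\<kappa>1 ` V1) (\<kappa>3 \<circ> \<psi> \<circ> inv_into V1 \<kappa>1)"
    using smooth(1) unfolding smooth_map_def by blast
  obtain L1 W1 where L1: "linear L1" "open W1" "V1 = L1 ` W1" "\<kappa>1 = inv L1" "range L1 = X"
      "\<And>v. inv L1 (L1 v) = v" "\<And>y. y \<in> X \<Longrightarrow> L1 (inv L1 y) = y"
    using linear_chartsE[OF V1(1)] by metis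
  obtain L2 where L2: "linear L2" "\<kappa>2 = inv L2" "range L2 = X"
      "\<And>v. inv L2 (L2 v) = v" "\<And>y. y \<in> X \<Longrightarrow> L2 (inv L2 y) = y"
    using linear_chartsE[OF V2] by metis
  have X: "subspace X"
    using linear_subspace_image[OF L1(1) subspace_UNIV] L1(5) by simp
  have lifted: "\<psi>' \<circ> g k \<circ> \<psi> \<in> X \<rightarrow> X" for k using psi'_X by simp
  obtain N P r K z where N: "is_norm_on X N" and P: "linear_self_map X P"
    and z: "z \<in> X" "z \<notin> P ` X" and r: "r > 0"
    and graph: "\<forall>n\<ge>K. \<forall>u\<in>trapped (\<lambda>k. \<psi>' \<circ> g k \<circ> \<psi>) (norm_ball X N r) n.
       \<forall>v\<in>trapped (\<lambda>k. \<psi>' \<circ> g k \<circ> \<psi>) (norm_ball X N r) n. N (u - v) \<le> N (P (u - v))"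
    by (rule NPH_trapped_orbits[OF X lifted NPH]) (rule that)
  define p where "p v = N (L1 v)" for v
  define P1 where "P1 = inv L1 \<circ> (P \<circ> L1)"
  have L1_X: "L1 v \<in> X" for v using L1(5) by auto
  have PX: "P y \<in> X" if "y \<in> X" for y using P that by (auto simp: linear_self_map_def)
  have L1_P1: "L1 (P1 v) = P (L1 v)" for v by (simp add: P1_def L1(7) PX L1_X)
  have L1_zero: "L1 v = 0 \<longleftrightarrow> v = 0" for v
    using L1(6)[of v] L1(6)[of 0] linear_0[OF L1(1)] by metis
  have p: "is_norm_on UNIV p"
    using N L1_X L1_zero unfolding is_norm_on_def p_def
    by (simp add: linear_add[OF L1(1)] linear_scale[OF L1(1)])
  have P1: "linear P1"
    unfolding P1_def
  proof (rule linear_inv_comp[OF L1(1,6)])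
    show "linear (P \<circ> L1)"
      using P L1_X unfolding linear_self_map_def
      by (intro linearI) (simp_all add: linear_add[OF L1(1)] linear_scale[OF L1(1)])
    show "range (P \<circ> L1) \<subseteq> range L1" using PX L1_X L1(5) by auto
  qed
  have range_P1: "range P1 \<noteq> UNIV"
  proof
    assume "range P1 = UNIV"
    then obtain v where "inv L1 z = P1 v" by (metis rangeE UNIV_I)
    then have "z = P (L1 v)" using L1(7)[OF z(1)] L1_P1 by metis
    with z(2) L1_X show False by blast
  qed
  obtain c where c: "c > 0" "\<And>v. p v \<le> c * norm v"
    using norm_on_equivalent[OF p] by metis
  define B where "B = W1 \<inter> ball 0 (r / c)"
  have B: "open B" "\<And>v. v \<in> B \<Longrightarrow> v \<in> W1 \<and> p v < r"
  proof -
    show "open B" unfolding B_def using L1(2) by auto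
    fix v assume v: "v \<in> B"
    then have "c * norm v < r" using c(1) by (simp add: B_def field_simps)
    with c(2)[of v] v show "v \<in> W1 \<and> p v < r" by (simp add: B_def)
  qed
  \<comment> \<open>Smoothness of \<open>\<psi>'\<close> is given in the linear coordinates \<open>L2\<close>, that of \<open>\<psi>\<close> in \<open>L1\<close>; the two differ
    by a linear automorphism.\<close>
  define f where "f = inv L1 \<circ> \<psi>'"
  have L1_f: "L1 (f q) = \<psi>' q" for q by (simp add: f_def L1(7) psi'_X)
  have hom: "open Ux" "homeomorphism Ux (\<phi> ` Ux) \<phi> (inv_into Ux \<phi>)"
    using atlas Ux(1) by (auto simp: smooth_atlas_def is_chart_def)
  have cont: "continuous_on Ux f"
  proof -
    have "linear (inv L1 \<circ> L2)" by (rule linear_inv_comp[OF L1(1,6) L2(1)]) (simp add: L1 L2)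
    then have lin: "continuous_on UNIV (inv L1 \<circ> L2)"
      by (intro linear_continuous_on) (simp only: linear_conv_bounded_linear)
    have "continuous_on Ux ((\<kappa>2 \<circ> \<psi>' \<circ> inv_into Ux \<phi>) \<circ> \<phi>)"
      by (rule continuous_on_compose[OF homeomorphism_cont1[OF hom(2)] smooth_on_imp_continuous_on[OF s2]])
    then have "continuous_on Ux ((inv L1 \<circ> L2) \<circ> ((\<kappa>2 \<circ> \<psi>' \<circ> inv_into Ux \<phi>) \<circ> \<phi>))"
      by (rule continuous_on_compose[OF _ continuous_on_subset[OF lin subset_UNIV]])
    then show ?thesis
    proof (rule continuous_on_eq)
      fix q assume "q \<in> Ux"
      then have "inv_into Ux \<phi> (\<phi> q) = q" using hom(2) by (auto simp: homeomorphism_def)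
      then show "((inv L1 \<circ> L2) \<circ> ((\<kappa>2 \<circ> \<psi>' \<circ> inv_into Ux \<phi>) \<circ> \<phi>)) q = f q"
        by (simp add: f_def L2(2,5) psi'_X)
    qed
  qed
  have fx: "f x = 0"
  proof -
    have "\<psi>' x = 0" using inv(1) V0 psi0 by blast
    then show ?thesis using L1_f[of x] L1_zero by simp
  qed
  define Q where "Q = U0 \<inter> (Ux \<inter> f -` B)"
  show thesis
  proof
    show "open Q"
      unfolding Q_def by (intro open_Int U0(1) continuous_open_preimage cont hom(1) B(1))
    have "inv L1 0 = 0" using L1(6)[of 0] linear_0[OF L1(1)] by simp
    moreover have "inv L1 0 \<in> W1" using imageI[OF V1(2), of "inv L1"] by (simp add: L1(3,6) image_image)
    ultimately have "0 \<in> B" using r c(1) by (simp add: B_def)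
    then show "x \<in> Q" using U0(2) Ux(2) fx by (simp add: Q_def)
    fix n assume n: "n \<ge> K"
    define C where "C = trapped g Q n"
    define D where "D = L1 -` trapped (\<lambda>k. \<psi>' \<circ> g k \<circ> \<psi>) (norm_ball X N r) n"
    have "negligible D"
    proof (rule negligible_Lipschitz_graph[OF p P1 range_P1])
      fix u v assume "u \<in> D" "v \<in> D"
      then have "N (L1 u - L1 v) \<le> N (P (L1 u - L1 v))"
        using graph n by (simp add: D_def)
      then show "p (u - v) \<le> p (P1 (u - v))"
        by (simp add: p_def L1_P1 linear_diff[OF L1(1)])
    qed
    have Q: "\<psi> (\<psi>' q) = q" "\<psi>' q \<in> norm_ball X N r" "f q \<in> W1" if "q \<in> Q" for q
      using that inv(2) U0(3) B(2)[of "f q"] psi'_X[of q]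
      by (auto simp: Q_def norm_ball_def p_def L1_f)
    have CQ: "C \<subseteq> Q" unfolding C_def by (rule trapped_subset)
    have fC: "f q \<in> D" if "q \<in> C" for q
    proof -
      have tr: "trajectory (\<lambda>i. g (n + i)) q j \<in> Q" for j using that by (simp add: C_def trapped_def)
      \<comment> \<open>\<open>\<psi>'\<close> conjugates \<open>g\<close> to the lifted system as long as the orbit stays where \<open>\<psi>\<close> inverts it.\<close>
      have "trajectory (\<lambda>i. \<psi>' \<circ> g (n + i) \<circ> \<psi>) (\<psi>' q) j = \<psi>' (trajectory (\<lambda>i. g (n + i)) q j)" for j
        by (induction j) (simp_all add: Q(1)[OF tr])
      then show ?thesis using Q(2)[OF tr] by (simp add: D_def trapped_def L1_f)
    qed
    have V1_W1: "\<kappa>1 ` V1 = W1" by (simp add: L1(3,4,6) image_image)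
    have inv_V1: "inv_into V1 \<kappa>1 v = L1 v" if "v \<in> W1" for v
    proof -
      have "inj_on \<kappa>1 V1" by (rule inj_onI) (auto simp: L1(3,4,6))
      then show ?thesis using inv_into_f_f[of \<kappa>1 V1 "L1 v"] that by (simp add: L1(3,4,6))
    qed
    have "negligible ((\<kappa>3 \<circ> \<psi> \<circ> inv_into V1 \<kappa>1) ` (D \<inter> W1))"
    proof (rule negligible_differentiable_image_negligible)
      show "negligible (D \<inter> W1)" using \<open>negligible D\<close> by (rule negligible_subset) auto
      show "(\<kappa>3 \<circ> \<psi> \<circ> inv_into V1 \<kappa>1) differentiable_on D \<inter> W1"
        using smooth_on_imp_differentiable_on[OF s1] V1_W1 by (auto intro: differentiable_on_subset)
    qed simp
    then have "negligible (\<kappa>3 ` C)"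
    proof (rule negligible_subset)
      show "\<kappa>3 ` C \<subseteq> (\<kappa>3 \<circ> \<psi> \<circ> inv_into V1 \<kappa>1) ` (D \<inter> W1)"
      proof (intro image_subsetI)
        fix q assume q: "q \<in> C"
        then have "q \<in> Q" using CQ by blast
        then have "\<kappa>3 q = (\<kappa>3 \<circ> \<psi> \<circ> inv_into V1 \<kappa>1) (f q)"
          using Q by (simp add: inv_V1 L1_f)
        then show "\<kappa>3 q \<in> (\<kappa>3 \<circ> \<psi> \<circ> inv_into V1 \<kappa>1) ` (D \<inter> W1)"
          using fC[OF q] Q(3)[OF \<open>q \<in> Q\<close>] by blast
      qed
    qed
    moreover have "C \<subseteq> V3"
    proof
      fix q assume "q \<in> C"
      then have "q \<in> Q" using CQ by blast
      then have "\<psi>' q \<in> V1" using Q(3) L1(3) L1_f by (metis imageI)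
      then show "q \<in> V3" using V3(2) Q(1)[OF \<open>q \<in> Q\<close>] by (metis image_subset_iff)
    qed
    ultimately show "measure_zero \<A> (trapped g Q n)"
      unfolding C_def[symmetric] by (intro measure_zero_in_chart[OF atlas V3(1)])
  qed
qed

section \<open>Avoidance of all NPH unstable fixed points\<close>

theorem theorem6p2:
  fixes \<A> :: "('a::{t2_space, second_countable_topology}, 'b::euclidean_space) chart set"
    and g :: "nat \<Rightarrow> 'a \<Rightarrow> 'a"
  assumes "smooth_structure \<A>"
    and "\<And>k. luzin_N_inverse \<A> (g k)"
  shows "avoids \<A> g {x. NPH_unstable_fixed_point \<A> g x}"
proof -
  have atlas: "smooth_atlas \<A>" using assms(1) by (simp add: smooth_structure_def)
  define \<Q> where "\<Q> = {Q. open Q \<and> (\<exists>K. \<forall>n\<ge>K. measure_zero \<A> (trapped g Q n))}"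
  obtain \<C> where C: "\<C> \<subseteq> \<Q>" "countable \<C>" "\<Union>\<C> = \<Union>\<Q>"
    using Lindelof[of \<Q>] by (auto simp: \<Q>_def)
  have "\<forall>Q\<in>\<C>. \<exists>K. \<forall>n\<ge>K. measure_zero \<A> (trapped g Q n)"
    using C(1) by (auto simp: \<Q>_def)
  then obtain K where K: "\<And>Q n. Q \<in> \<C> \<Longrightarrow> n \<ge> K Q \<Longrightarrow> measure_zero \<A> (trapped g Q n)"
    by metis
  have "measure_zero \<A> (\<Union>Q\<in>\<C>. \<Union>n\<in>{K Q..}. {x. trajectory g x n \<in> trapped g Q n})"
    by (intro measure_zero_UN C(2) measure_zero_trajectory_preimage assms(2) K) auto
  moreover have "{x0. \<exists>s\<in>{x. NPH_unstable_fixed_point \<A> g x}. trajectory g x0 \<longlonglongrightarrow> s}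
      \<subseteq> (\<Union>Q\<in>\<C>. \<Union>n\<in>{K Q..}. {x. trajectory g x n \<in> trapped g Q n})"
  proof clarify
    fix x0 s assume s: "NPH_unstable_fixed_point \<A> g s" and lim: "trajectory g x0 \<longlonglongrightarrow> s"
    obtain Q0 K0 where "open Q0" "s \<in> Q0" "\<And>n. n \<ge> K0 \<Longrightarrow> measure_zero \<A> (trapped g Q0 n)"
      using NPH_neighbourhood[OF atlas s] by metis
    then have "s \<in> \<Union>\<Q>" unfolding \<Q>_def by blast
    then obtain Q where Q: "Q \<in> \<C>" "s \<in> Q" using C(3) by blast
    then have "open Q" using C(1) by (auto simp: \<Q>_def)
    then obtain n0 where n0: "\<And>m. m \<ge> n0 \<Longrightarrow> trajectory g x0 m \<in> Q"
      using topological_tendstoD[OF lim _ Q(2)] by (auto simp: eventually_sequentially)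
    have "trajectory g x0 (max n0 (K Q)) \<in> trapped g Q (max n0 (K Q))"
      unfolding trapped_def by (auto simp flip: trajectory_add intro!: n0)
    then show "x0 \<in> (\<Union>Q\<in>\<C>. \<Union>n\<in>{K Q..}. {x. trajectory g x n \<in> trapped g Q n})"
      using Q(1) by fastforce
  qed
  ultimately show ?thesis
    unfolding avoids_def by (rule measure_zero_subset)
qed

end
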